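(* The class of $(\overline{2P_1+P_2},\,2P_1+P_3)$-free graphs has bounded clique-width.
   Context: All graphs are finite, simple and undirected. For graphs $H_1,\dots,H_p$, a graph $G$ is $(H_1,\dots,H_p)$-free if no induced subgraph of $G$ is isomorphic to any $H_i$. $P_r$ denotes the path on $r$ vertices; $G+H$ is the disjoint union of $G$ and $H$, and $rG$ is the disjoint union of $r$ copies of $G$; $\overline{G}$ is the complement of $G$. Thus $\overline{2P_1+P_2}$ is the diamond ($K_4$ minus an edge). The clique-width of a graph $G$ is the minimum number of labels needed to construct $G$ using the operations: (1) create a single vertex with label $i$; (2) take the disjoint union of two labelled graphs; (3) add all edges between vertices with label $i$ and vertices with label $j$ ($i\ne j$); (4) rename label $i$ to $j$. A class of graphs has bounded clique-width if there is a constant $c$ such that every graph in the class has clique-width at most $c$. *)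

theory Defs
  imports
    "Graph_Theory.Graph_Theory"
    "HOL-Library.Extended_Nat"
begin

text \<open>
  Finite simple undirected graphs are rendered by \<^term>\<open>pair_graph\<close>: an edge between \<open>u\<close> and \<open>v\<close> is
  represented by the two arcs \<open>(u, v)\<close> and \<open>(v, u)\<close>.
\<close>

definition path_graph :: "nat \<Rightarrow> nat pair_pre_digraph" where
  "path_graph r = \<lparr> pverts = {..<r},
     parcs = {(u, v). u < r \<and> v < r \<and> (v = Suc u \<or> u = Suc v)} \<rparr>"

definition disjoint_sum ::
  "'a pair_pre_digraph \<Rightarrow> 'b pair_pre_digraph \<Rightarrow> ('a + 'b) pair_pre_digraph" where
  "disjoint_sum G H = \<lparr> pverts = pverts G <+> pverts H,
     parcs = map_prod Inl Inl ` parcs G \<union> map_prod Inr Inr ` parcs H \<rparr>"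

definition copies :: "nat \<Rightarrow> 'a pair_pre_digraph \<Rightarrow> (nat \<times> 'a) pair_pre_digraph" where
  "copies r G = \<lparr> pverts = {..<r} \<times> pverts G,
     parcs = {((i, u), (i, v)) | i u v. i < r \<and> (u, v) \<in> parcs G} \<rparr>"

definition complement_graph :: "'a pair_pre_digraph \<Rightarrow> 'a pair_pre_digraph" where
  "complement_graph G = \<lparr> pverts = pverts G,
     parcs = {(u, v). u \<in> pverts G \<and> v \<in> pverts G \<and> u \<noteq> v \<and> (u, v) \<notin> parcs G} \<rparr>"

definition free_of :: "'b pair_pre_digraph \<Rightarrow> 'a pair_pre_digraph \<Rightarrow> bool" where
  "free_of H G \<longleftrightarrow>
     \<not> (\<exists>F. induced_subgraph F (with_proj G) \<and> digraph_iso F (with_proj H))"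

text \<open>
  \<open>cw_construct k G l\<close>: the graph \<open>G\<close> with vertex labelling \<open>l\<close> can be constructed by the four
  clique-width operations using labels \<open>0, \<dots>, k - 1\<close>. Only the values of \<open>l\<close> on the vertices
  of \<open>G\<close> are meaningful.
\<close>

inductive cw_construct :: "nat \<Rightarrow> 'a pair_pre_digraph \<Rightarrow> ('a \<Rightarrow> nat) \<Rightarrow> bool" for k where
  create:
    "i < k \<Longrightarrow> cw_construct k \<lparr> pverts = {v}, parcs = {} \<rparr> (\<lambda>_. i)"
| disjoint_union:
    "cw_construct k G l \<Longrightarrow> cw_construct k H m \<Longrightarrow> pverts G \<inter> pverts H = {} \<Longrightarrow>
     cw_construct k \<lparr> pverts = pverts G \<union> pverts H, parcs = parcs G \<union> parcs H \<rparr>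
       (\<lambda>v. if v \<in> pverts G then l v else m v)"
| join:
    "cw_construct k G l \<Longrightarrow> i < k \<Longrightarrow> j < k \<Longrightarrow> i \<noteq> j \<Longrightarrow>
     cw_construct k \<lparr> pverts = pverts G,
       parcs = parcs G \<union> {(u, v). u \<in> pverts G \<and> v \<in> pverts G \<and>
         (l u = i \<and> l v = j \<or> l u = j \<and> l v = i)} \<rparr> l"
| relabel:
    "cw_construct k G l \<Longrightarrow> i < k \<Longrightarrow> j < k \<Longrightarrow>
     cw_construct k G (\<lambda>v. if l v = i then j else l v)"

text \<open>
  The operations only produce graphs with at least one vertex; the graph without vertices is given
  clique-width \<open>0\<close>. A graph with no construction at all would get the value \<open>\<infinity>\<close>.
\<close>

definition clique_width :: "'a pair_pre_digraph \<Rightarrow> enat" where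
  "clique_width G =
     (if pverts G = {} then 0 else (INF k \<in> {k. \<exists>l. cw_construct k G l}. enat k))"

text \<open>
  A graph class is represented by its members with vertices in a fixed type \<open>'a\<close>. Every finite
  graph has an isomorphic copy on \<^typ>\<open>nat\<close>, so for an isomorphism-closed class the constant
  \<open>c\<close> obtained for \<^typ>\<open>nat\<close> is valid for all finite graphs of the class.
\<close>

definition bounded_clique_width :: "'a pair_pre_digraph set \<Rightarrow> bool" where
  "bounded_clique_width C \<longleftrightarrow> (\<exists>c::nat. \<forall>G\<in>C. clique_width G \<le> enat c)"

end

theory Submission
  imports Defs "HOL-Library.Ramsey"
begin

text \<open>
  Call a vertex low (high) for a set if it has at most one neighbour (non-neighbour) in it. In a
  \<open>(2P\<^sub>1 + P\<^sub>3)\<close>-free graph every vertex is low or high for every independent set \<open>I\<close>.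
  If \<open>\<bar>I\<bar> \<ge> 6\<close>, the vertices \<open>D\<close> that are not low are independent because there is no
  diamond, and the low ones induce a disjoint union of cliques, because a \<open>P\<^sub>3\<close> among them would
  leave two vertices of \<open>I\<close> untouched. If \<open>D\<close> is large as well, then, up to two vertices, the
  graph consists of \<open>D\<close>, an independent set joined to \<open>D\<close> by the complement of a matching,
  and a clique joined to \<open>D\<close> by a matching. If there is no independent set of size 6, Ramsey's
  theorem and diamond-freeness split all but boundedly many vertices into at most five large
  cliques with matchings between them; if there are at least four, an edge between two of them
  extends to an induced \<open>2P\<^sub>1 + P\<^sub>3\<close>.

  So in all cases, up to boundedly many vertices and complementations between boundedly many
  classes, the graph is a disjoint union of cliques or has maximum degree at most 2. Both kinds
  have a vertex order in which every initial segment sees its complement in boundedly many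
  different ways, and such an order bounds the clique-width.
\<close>

section \<open>Linear layouts\<close>

text \<open>With \<open>Q\<close> the complement of \<open>P\<close>, the number of these sets is
  the cut function of linear module-width: it counts the distinct rows of the adjacency matrix
  between \<open>P\<close> and \<open>Q\<close>.\<close>

definition nbhds :: "('a \<Rightarrow> 'a \<Rightarrow> bool) \<Rightarrow> 'a set \<Rightarrow> 'a set \<Rightarrow> 'a set set" where
  "nbhds E P Q = (\<lambda>u. {w \<in> Q. E u w}) ` P"

text \<open>A derivation of \<open>layout k V E V\<close> is a vertex order of linear module-width
  at most \<open>k\<close>. The initial segment \<open>P\<close> is an argument so that inductions
  can follow the order vertex by vertex.\<close>

inductive layout :: "nat \<Rightarrow> 'a set \<Rightarrow> ('a \<Rightarrow> 'a \<Rightarrow> bool) \<Rightarrow> 'a set \<Rightarrow> bool" for k V E where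
  empty: "layout k V E {}"
| step: "layout k V E P \<Longrightarrow> v \<in> V - P \<Longrightarrow>
    card (nbhds E (insert v P) (V - insert v P)) \<le> k \<Longrightarrow> layout k V E (insert v P)"

lemma layout_subset: "layout k V E P \<Longrightarrow> P \<subseteq> V"
  by (induction rule: layout.induct) auto

lemma layout_finite: "layout k V E P \<Longrightarrow> finite P"
  by (induction rule: layout.induct) auto

lemma layout_mono: "layout k V E P \<Longrightarrow> k \<le> k' \<Longrightarrow> layout k' V E P"
  by (induction rule: layout.induct) (auto intro: layout.intros)

text \<open>Vertex orders need not be written down: an invariant of initial segments that survives
  some next vertex and bounds the cut is enough.\<close>

lemma layout_greedy:
  assumes "finite V" and "Inv {}"
    and ext: "\<And>P. P \<subset> V \<Longrightarrow> Inv P \<Longrightarrow> \<exists>v\<in>V - P. Inv (insert v P)"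
    and bound: "\<And>P. P \<subseteq> V \<Longrightarrow> Inv P \<Longrightarrow> card (nbhds E P (V - P)) \<le> k"
  shows "layout k V E V"
proof -
  have "\<exists>P\<subseteq>V. card P = n \<and> Inv P \<and> layout k V E P" if "n \<le> card V" for n
    using that
  proof (induction n)
    case 0
    show ?case using assms(2) layout.empty by fastforce
  next
    case (Suc n)
    then obtain P where P: "P \<subseteq> V" "card P = n" "Inv P" "layout k V E P"
      by auto
    with Suc.prems have "P \<subset> V" by auto
    then obtain v where v: "v \<in> V - P" "Inv (insert v P)" using ext P by blast
    have "layout k V E (insert v P)"
      using P v bound[of "insert v P"] by (intro layout.step) auto
    moreover have "card (insert v P) = Suc n"
      using P v finite_subset[OF P(1) \<open>finite V\<close>] by auto
    ultimately show ?case using P v by (intro exI[of _ "insert v P"]) auto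
  qed
  from this[of "card V"] show ?thesis
    using card_subset_eq[OF \<open>finite V\<close>] by auto
qed

lemma card_image_le_factor:
  assumes "finite P" and "\<And>u w. u \<in> P \<Longrightarrow> w \<in> P \<Longrightarrow> h u = h w \<Longrightarrow> f u = f w"
  shows "card (f ` P) \<le> card (h ` P)"
proof -
  have "f ` P \<subseteq> (\<lambda>y. f (inv_into P h y)) ` (h ` P)"
  proof
    fix y assume "y \<in> f ` P"
    then obtain u where u: "u \<in> P" "y = f u" by auto
    have "inv_into P h (h u) \<in> P" "h (inv_into P h (h u)) = h u"
      using u by (auto simp: inv_into_into f_inv_into_f)
    then have "y = f (inv_into P h (h u))" using assms(2) u by metis
    with u show "y \<in> (\<lambda>y. f (inv_into P h y)) ` (h ` P)" by blast
  qed
  with assms(1) show ?thesis by (meson surj_card_le finite_imageI)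
qed

text \<open>The same order works: colour and \<open>H\<close>-row of a vertex determine its
  \<open>E\<close>-row, so a cut has at most \<open>card C\<close> times as many rows. Only pairs on
  different sides of a cut are compared, hence the conditions \<open>u \<noteq> w\<close> and
  \<open>u' \<noteq> w\<close>.\<close>

lemma layout_refine:
  assumes "layout t V H P" and "finite C" and "c ` V \<subseteq> C"
    and same: "\<And>u u' w. u \<in> V \<Longrightarrow> u' \<in> V \<Longrightarrow> w \<in> V \<Longrightarrow> u \<noteq> w \<Longrightarrow> u' \<noteq> w \<Longrightarrow> c u = c u' \<Longrightarrow>
      H u w = H u' w \<Longrightarrow> E u w = E u' w"
  shows "layout (card C * t) V E P"
  using assms(1)
proof (induction rule: layout.induct)
  case empty
  show ?case by (rule layout.empty)
next
  case (step P v)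
  let ?P = "insert v P" and ?Q = "V - insert v P"
  have sub: "?P \<subseteq> V" and fin: "finite ?P"
    using layout_subset[OF step.hyps(1)] layout_finite[OF step.hyps(1)] step.hyps(2) by auto
  have "card (nbhds E ?P ?Q) \<le> card ((\<lambda>u. (c u, {w \<in> ?Q. H u w})) ` ?P)"
    unfolding nbhds_def
  proof (rule card_image_le_factor[OF fin])
    fix u u' assume *: "u \<in> ?P" "u' \<in> ?P" "(c u, {w \<in> ?Q. H u w}) = (c u', {w \<in> ?Q. H u' w})"
    have "E u w = E u' w" if w: "w \<in> ?Q" for w
    proof -
      have "w \<in> {w \<in> ?Q. H u w} \<longleftrightarrow> w \<in> {w \<in> ?Q. H u' w}"
        using *(3) by simp
      with w have "H u w = H u' w" by simp
      moreover have "u \<in> V" "u' \<in> V" "w \<in> V" "u \<noteq> w" "u' \<noteq> w" "c u = c u'"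
        using * w sub by auto
      ultimately show ?thesis by (intro same)
    qed
    then show "{w \<in> ?Q. E u w} = {w \<in> ?Q. E u' w}" by blast
  qed
  also have "\<dots> \<le> card (C \<times> nbhds H ?P ?Q)"
    using assms(2,3) sub fin by (intro card_mono) (auto simp: nbhds_def)
  also have "\<dots> \<le> card C * t"
    using step.hyps(3) by (simp add: card_cartesian_product)
  finally show ?case using step by (intro layout.step) auto
qed

text \<open>The vertices outside \<open>S\<close> are separated by their colour and their neighbours in \<open>S\<close>, so a
  bounded exceptional set costs only a factor.\<close>

lemma layout_modify:
  assumes "layout t V H V" and "finite S" and "card S \<le> s" and "c ` V \<subseteq> {..<k}"
    and H: "\<And>u w. u \<in> V - S \<Longrightarrow> w \<in> V - S \<Longrightarrow> u \<noteq> w \<Longrightarrow> H u w \<longleftrightarrow> E u w \<noteq> R (c u) (c w)"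
  shows "layout ((s + k * 2 ^ s) * t) V E V"
proof -
  define d where "d u = (if u \<in> S then Inl u else Inr (c u, {x \<in> S. E u x}))" for u
  define C where "C = S <+> ({..<k} \<times> Pow S)"
  have "layout (card C * t) V E V"
  proof (rule layout_refine[OF assms(1), where c = d])
    show "finite C" "d ` V \<subseteq> C" using assms by (auto simp: C_def d_def)
    fix u u' w
    assume *: "u \<in> V" "u' \<in> V" "w \<in> V" "u \<noteq> w" "u' \<noteq> w" "d u = d u'" "H u w = H u' w"
    consider "u = u'" | "u \<notin> S" "u' \<notin> S" "c u = c u'" "{x \<in> S. E u x} = {x \<in> S. E u' x}"
      using *(6) by (auto simp: d_def split: if_splits)
    then show "E u w = E u' w"
    proof cases
      case 2
      \<comment> \<open>Towards \<open>S\<close> the colour \<open>d\<close> records adjacency;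
        elsewhere \<open>E\<close> is recovered from \<open>H\<close> and \<open>R\<close>.\<close>
      show ?thesis
      proof (cases "w \<in> S")
        case True
        then show ?thesis using 2 by blast
      next
        case False
        then show ?thesis using H[of u w] H[of u' w] * 2 by auto
      qed
    qed auto
  qed
  moreover have "card C = card S + k * 2 ^ card S"
    using assms(2) by (simp add: C_def card_Plus card_cartesian_product card_Pow)
  then have "card C \<le> s + k * 2 ^ s"
    using assms(3) by (simp add: add_mono power_increasing)
  ultimately show ?thesis using layout_mono mult_le_mono1 by blast
qed

text \<open>At most two edges ever leave the current segment. Adding the outer end of a leaving edge
  loses that edge and gains at most one; if no edge leaves, a vertex of a new component contributes
  at most two. The three rows of a cut are the empty one and one per leaving edge.\<close>

lemma layout_degree_le_2:
  assumes "finite V" and sym: "\<And>u w. H u w \<Longrightarrow> H w u"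
    and deg: "\<And>u. u \<in> V \<Longrightarrow> card {w \<in> V. H u w} \<le> 2"
  shows "layout 3 V H V"
proof -
  define cut where "cut P = {(u, w). u \<in> P \<and> w \<in> V - P \<and> H u w}" for P
  have fin: "finite (cut P)" if "P \<subseteq> V" for P
    using that assms(1) finite_subset[of "cut P" "V \<times> V"] by (auto simp: cut_def)
  show ?thesis
  proof (rule layout_greedy[where Inv = "\<lambda>P. card (cut P) \<le> 2", OF assms(1)])
    show "card (cut {}) \<le> 2" by (simp add: cut_def)
  next
    fix P assume P: "P \<subset> V" "card (cut P) \<le> 2"
    show "\<exists>v\<in>V - P. card (cut (insert v P)) \<le> 2"
    proof (cases "cut P = {}")
      case True
      obtain v where v: "v \<in> V - P" using P by auto
      have "cut (insert v P) \<subseteq> Pair v ` {w \<in> V. H v w}"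
        using True by (auto simp: cut_def)
      then have "card (cut (insert v P)) \<le> card {w \<in> V. H v w}"
        using assms(1) by (intro surj_card_le) auto
      with v deg show ?thesis by (metis DiffD1 order_trans)
    next
      case False
      then obtain u w where uw: "(u, w) \<in> cut P" by auto
      then have w: "u \<in> P" "w \<in> V - P" "H u w" "H w u" by (auto simp: cut_def sym)
      have "cut (insert w P) \<subseteq> (cut P - {(u, w)}) \<union> Pair w ` ({x \<in> V. H w x} - {u})"
        using w by (auto simp: cut_def)
      then have "card (cut (insert w P)) \<le>
          card ((cut P - {(u, w)}) \<union> Pair w ` ({x \<in> V. H w x} - {u}))"
        using fin P assms(1) by (intro card_mono) auto
      also have "\<dots> \<le> card (cut P - {(u, w)}) + card ({x \<in> V. H w x} - {u})"
        using assms(1) by (intro order_trans[OF card_Un_le] add_mono card_image_le) auto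
      also have "\<dots> \<le> 2"
        using uw w P deg[of w] by (auto simp: card_Diff_singleton_if)
      finally show ?thesis using w by blast
    qed
  next
    fix P assume P: "P \<subseteq> V" "card (cut P) \<le> 2"
    have "nbhds H P (V - P) \<subseteq> insert {} ((\<lambda>e. {w \<in> V - P. H (fst e) w}) ` cut P)"
    proof
      fix X assume "X \<in> nbhds H P (V - P)"
      then obtain u where u: "u \<in> P" "X = {w \<in> V - P. H u w}" by (auto simp: nbhds_def)
      show "X \<in> insert {} ((\<lambda>e. {w \<in> V - P. H (fst e) w}) ` cut P)"
      proof (cases "X = {}")
        case False
        then obtain w where "(u, w) \<in> cut P" using u by (auto simp: cut_def)
        with u show ?thesis by force
      qed simp
    qed
    then have "card (nbhds H P (V - P)) \<le> card (insert {} ((\<lambda>e. {w \<in> V - P. H (fst e) w}) ` cut P))"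
      using fin[OF P(1)] by (intro card_mono) auto
    also have "\<dots> \<le> Suc (card (cut P))"
      using card_image_le[OF fin[OF P(1)], of "\<lambda>e. {w \<in> V - P. H (fst e) w}"] fin[OF P(1)]
      by (simp add: card_insert_if)
    finally show "card (nbhds H P (V - P)) \<le> 3" using P by simp
  qed
qed

text \<open>Cliques are listed one after another. The invariant says that at most one clique is
  split: all vertices of \<open>P\<close> with a neighbour outside see the same outside vertices, so
  a cut has only this row and the empty one.\<close>

lemma layout_cluster:
  assumes "finite V" and sym: "\<And>u w. H u w \<Longrightarrow> H w u"
    and trans: "\<And>u v w. H u v \<Longrightarrow> H v w \<Longrightarrow> u \<noteq> w \<Longrightarrow> H u w"
  shows "layout 2 V H V"
proof (rule layout_greedy[where
      Inv = "\<lambda>P. \<forall>u\<in>P. \<forall>u'\<in>P. \<forall>w\<in>V - P. \<forall>w'\<in>V - P. H u w \<longrightarrow> H u' w' \<longrightarrow> H u w'", OF assms(1)])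
  fix P assume P: "P \<subset> V"
    and inv: "\<forall>u\<in>P. \<forall>u'\<in>P. \<forall>w\<in>V - P. \<forall>w'\<in>V - P. H u w \<longrightarrow> H u' w' \<longrightarrow> H u w'"
  let ?I = "\<lambda>P. \<forall>u\<in>P. \<forall>u'\<in>P. \<forall>w\<in>V - P. \<forall>w'\<in>V - P. H u w \<longrightarrow> H u' w' \<longrightarrow> H u w'"
  show "\<exists>v\<in>V - P. ?I (insert v P)"
  proof (cases "\<exists>u\<in>P. \<exists>w\<in>V - P. H u w")
    case True
    \<comment> \<open>A split clique is continued before a new one is begun.\<close>
    then obtain u v where uv: "u \<in> P" "v \<in> V - P" "H u v" by blast
    have "H x v" if "x \<in> P" "w \<in> V - P" "H x w" for x w
      using inv uv that by blast
    then have "?I (insert v P)"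
      using inv uv by (smt (verit) Diff_iff insert_iff sym trans)
    with uv show ?thesis by blast
  next
    case False
    moreover obtain v where "v \<in> V - P" using P by auto
    ultimately show ?thesis by (intro bexI[of _ v]) auto
  qed
next
  fix P assume P: "P \<subseteq> V"
    and inv: "\<forall>u\<in>P. \<forall>u'\<in>P. \<forall>w\<in>V - P. \<forall>w'\<in>V - P. H u w \<longrightarrow> H u' w' \<longrightarrow> H u w'"
  have "nbhds H P (V - P) \<subseteq> {{}, {w \<in> V - P. \<exists>u\<in>P. H u w}}"
    using inv by (auto simp: nbhds_def)
  then have "card (nbhds H P (V - P)) \<le> card {{}, {w \<in> V - P. \<exists>u\<in>P. H u w}}"
    by (intro card_mono) auto
  also have "\<dots> \<le> 2" by (simp add: card_insert_if)
  finally show "card (nbhds H P (V - P)) \<le> 2" .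
qed auto

section \<open>From layouts to clique-width\<close>

definition graph_on :: "'a set \<Rightarrow> ('a \<Rightarrow> 'a \<Rightarrow> bool) \<Rightarrow> 'a pair_pre_digraph" where
  "graph_on P E = \<lparr> pverts = P, parcs = {(u, v). u \<in> P \<and> v \<in> P \<and> E u v} \<rparr>"

lemma graph_on_simps [simp]:
  "pverts (graph_on P E) = P"
  "parcs (graph_on P E) = {(u, v). u \<in> P \<and> v \<in> P \<and> E u v}"
  by (simp_all add: graph_on_def)

lemma graph_on_cong:
  "(\<And>u v. u \<in> P \<Longrightarrow> v \<in> P \<Longrightarrow> E u v = F u v) \<Longrightarrow> graph_on P E = graph_on P F"
  by (auto simp: graph_on_def)

lemma cw_join_many:
  assumes "cw_construct m (graph_on P E) l" and "J \<subseteq> {..<m} - {j}" and "j < m"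
  shows "cw_construct m
    (graph_on P (\<lambda>u v. E u v \<or> l u \<in> J \<and> l v = j \<or> l u = j \<and> l v \<in> J)) l"
proof -
  have "finite J" using assms(2) finite_subset by blast
  then show ?thesis using assms(2)
  proof (induction J)
    case empty
    show ?case using assms(1) by simp
  next
    case (insert i J)
    let ?E = "\<lambda>J u v. E u v \<or> l u \<in> J \<and> l v = j \<or> l u = j \<and> l v \<in> J"
    have "cw_construct m (graph_on P (?E J)) l" using insert by auto
    from cw_construct.join[OF this, of i j] insert.prems assms(3)
    have "cw_construct m \<lparr> pverts = P, parcs = parcs (graph_on P (?E J)) \<union>
        {(u, v). u \<in> P \<and> v \<in> P \<and> (l u = i \<and> l v = j \<or> l u = j \<and> l v = i)} \<rparr> l"
      by auto
    also have "\<lparr> pverts = P, parcs = parcs (graph_on P (?E J)) \<union>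
        {(u, v). u \<in> P \<and> v \<in> P \<and> (l u = i \<and> l v = j \<or> l u = j \<and> l v = i)} \<rparr>
      = graph_on P (?E (insert i J))"
      by (auto simp: graph_on_def)
    finally show ?case .
  qed
qed

text \<open>A second set of labels makes an arbitrary simultaneous relabelling a sequence of single
  ones: label \<open>i\<close> first moves to \<open>m + f i\<close>, then back to \<open>f i\<close>.\<close>

lemma cw_relabel_many:
  assumes "cw_construct (2 * m) G l" and "\<And>u. u \<in> pverts G \<Longrightarrow> l u < m"
    and f: "\<And>i. i < m \<Longrightarrow> f i < m"
  shows "\<exists>l'. cw_construct (2 * m) G l' \<and> (\<forall>u\<in>pverts G. l' u = f (l u))"
proof -
  \<comment> \<open>\<open>g n\<close> and \<open>h n\<close> describe the labels after
    \<open>n\<close> single moves of the first and of the second pass.\<close>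
  define g where "g n x = (if x < n then m + f x else x)" for n x
  define h where "h n y = (if m \<le> y \<and> y < m + n then y - m else y)" for n y
  have g: "cw_construct (2 * m) G (\<lambda>v. g n (l v))" if "n \<le> m" for n
    using that
  proof (induction n)
    case 0
    show ?case using assms(1) by (simp add: g_def)
  next
    case (Suc n)
    then have "cw_construct (2 * m) G
        (\<lambda>v. if g n (l v) = n then m + f n else g n (l v))"
      using f[of n] by (intro cw_construct.relabel) auto
    also have "(\<lambda>v. if g n (l v) = n then m + f n else g n (l v)) = (\<lambda>v. g (Suc n) (l v))"
      using Suc.prems by (auto simp: g_def fun_eq_iff less_Suc_eq)
    finally show ?case .
  qed
  have h: "cw_construct (2 * m) G (\<lambda>v. h n (g m (l v)))" if "n \<le> m" for n
    using that
  proof (induction n)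
    case 0
    have "h 0 = id" by (auto simp: h_def fun_eq_iff)
    then show ?case using g[of m] by simp
  next
    case (Suc n)
    let ?y = "\<lambda>v. g m (l v)"
    have "cw_construct (2 * m) G (\<lambda>v. if h n (?y v) = m + n then n else h n (?y v))"
      using Suc by (intro cw_construct.relabel) auto
    also have "(\<lambda>v. if h n (?y v) = m + n then n else h n (?y v)) = (\<lambda>v. h (Suc n) (?y v))"
      using Suc.prems by (auto simp: h_def fun_eq_iff)
    finally show ?case .
  qed
  have "h m (g m (l u)) = f (l u)" if "u \<in> pverts G" for u
    using assms(2)[OF that] f by (auto simp: h_def g_def)
  with h[of m] show ?thesis by blast
qed

text \<open>Since equally labelled vertices have the same neighbours outside \<open>P\<close>, the
  next vertex can be joined to whole label classes. It enters with the free label \<open>k\<close>;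
  the resulting \<open>Suc k\<close> labels are doubled for the simultaneous relabelling.\<close>

lemma layout_cw_construct:
  assumes "layout k V E P" and "P \<noteq> {}" and sym: "\<And>u w. E u w \<Longrightarrow> E w u" and irr: "\<And>u. \<not> E u u"
  shows "\<exists>l. cw_construct (2 * Suc k) (graph_on P E) l \<and> (\<forall>u\<in>P. l u < k) \<and>
    (\<forall>u\<in>P. \<forall>u'\<in>P. l u = l u' \<longrightarrow> (\<forall>w\<in>V - P. E u w = E u' w))"
  using assms(1,2)
proof (induction rule: layout.induct)
  case empty
  then show ?case by simp
next
  case (step P v)
  let ?m = "2 * Suc k" and ?P = "insert v P" and ?Q = "V - insert v P"
  have finP: "finite P" by (rule layout_finite) fact
  have "\<exists>l. cw_construct ?m (graph_on ?P E) l \<and> (\<forall>u\<in>?P. l u \<le> k) \<and>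
    (\<forall>u\<in>?P. \<forall>u'\<in>?P. l u = l u' \<longrightarrow> (\<forall>w\<in>?Q. E u w = E u' w))"
  proof (cases "P = {}")
    case True
    have "cw_construct ?m \<lparr> pverts = {v}, parcs = {} \<rparr> (\<lambda>_. 0)"
      by (rule cw_construct.create) simp
    also have "\<lparr> pverts = {v}, parcs = {} \<rparr> = graph_on ?P E"
      using True irr by (auto simp: graph_on_def)
    finally show ?thesis using True by (intro exI[of _ "\<lambda>_. 0"]) auto
  next
    case False
    with step.IH obtain l where l: "cw_construct ?m (graph_on P E) l" "\<forall>u\<in>P. l u < k"
      "\<forall>u\<in>P. \<forall>u'\<in>P. l u = l u' \<longrightarrow> (\<forall>w\<in>V - P. E u w = E u' w)"
      by blast
    define l1 where "l1 u = (if u \<in> P then l u else k)" for u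
    \<comment> \<open>Before the join the new vertex \<open>v\<close> is isolated. \<open>J\<close>
      consists of the labels it has to be joined to; each label class lies entirely inside or
      entirely outside its neighbourhood.\<close>
    define E0 where "E0 u w \<longleftrightarrow> u \<in> P \<and> w \<in> P \<and> E u w" for u w
    define J where "J = l ` {u \<in> P. E u v}"
    have "cw_construct ?m \<lparr> pverts = {v}, parcs = {} \<rparr> (\<lambda>_. k)"
      by (rule cw_construct.create) simp
    from cw_construct.disjoint_union[OF l(1) this] step.hyps(2)
    have "cw_construct ?m \<lparr> pverts = P \<union> {v}, parcs = parcs (graph_on P E) \<rparr> l1"
      by (simp add: l1_def[abs_def])
    also have "\<lparr> pverts = P \<union> {v}, parcs = parcs (graph_on P E) \<rparr> = graph_on ?P E0"
      by (auto simp: graph_on_def E0_def)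
    finally have 1: "cw_construct ?m (graph_on ?P E0) l1" .
    have "J \<subseteq> {..<?m} - {k}" using l(2) by (force simp: J_def)
    from cw_join_many[OF 1 this]
    have "cw_construct ?m (graph_on ?P
        (\<lambda>u w. E0 u w \<or> l1 u \<in> J \<and> l1 w = k \<or> l1 u = k \<and> l1 w \<in> J)) l1"
      by simp
    also have "graph_on ?P (\<lambda>u w. E0 u w \<or> l1 u \<in> J \<and> l1 w = k \<or> l1 u = k \<and> l1 w \<in> J)
      = graph_on ?P E"
    proof (rule graph_on_cong)
      fix u w assume uw: "u \<in> ?P" "w \<in> ?P"
      have k: "l1 x = k \<longleftrightarrow> x = v" if "x \<in> ?P" for x
        using that l(2) step.hyps(2) by (auto simp: l1_def)
      have J: "l1 x \<in> J \<longleftrightarrow> x \<in> P \<and> E x v" if "x \<in> ?P" for x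
      proof
        assume x: "l1 x \<in> J"
        then obtain y where y: "y \<in> P" "E y v" "l1 x = l y" by (auto simp: J_def)
        then have "x \<in> P" using l(2) by (auto simp: l1_def split: if_splits)
        moreover from this have "l x = l y" using y(3) by (simp add: l1_def)
        ultimately show "x \<in> P \<and> E x v" using y l(3) step.hyps(2) by blast
      next
        assume "x \<in> P \<and> E x v"
        then show "l1 x \<in> J" by (simp add: l1_def J_def)
      qed
      show "(E0 u w \<or> l1 u \<in> J \<and> l1 w = k \<or> l1 u = k \<and> l1 w \<in> J) = E u w"
        using k[OF uw(1)] k[OF uw(2)] J[OF uw(1)] J[OF uw(2)] uw irr sym
        by (auto simp: E0_def)
    qed
    finally have 2: "cw_construct ?m (graph_on ?P E) l1" .
    moreover have "\<forall>u\<in>?P. l1 u \<le> k" using l(2) by (auto simp: l1_def)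
    moreover have "E u w = E u' w"
      if "u \<in> ?P" "u' \<in> ?P" "l1 u = l1 u'" "w \<in> ?Q" for u u' w
    proof -
      have "u = u' \<or> u \<in> P \<and> u' \<in> P \<and> l u = l u'"
        using that(1-3) l(2) step.hyps(2) by (auto simp: l1_def split: if_splits)
      then show ?thesis using l(3) that(4) by blast
    qed
    ultimately show ?thesis by blast
  qed
  then obtain l where l: "cw_construct ?m (graph_on ?P E) l" "\<forall>u\<in>?P. l u \<le> k"
    "\<forall>u\<in>?P. \<forall>u'\<in>?P. l u = l u' \<longrightarrow> (\<forall>w\<in>?Q. E u w = E u' w)"
    by blast
  \<comment> \<open>The bound on the cut allows numbering the outside neighbourhoods below
    \<open>k\<close>. These numbers become the new labels, which frees label \<open>k\<close>
    again.\<close>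
  have fin: "finite (nbhds E ?P ?Q)" using finP by (simp add: nbhds_def)
  then obtain b where b: "bij_betw b (nbhds E ?P ?Q) {0..<card (nbhds E ?P ?Q)}"
    using ex_bij_betw_finite_nat by blast
  define N where "N u = {w \<in> ?Q. E u w}" for u
  have bN: "b (N u) < k" if "u \<in> ?P" for u
  proof -
    have "N u \<in> nbhds E ?P ?Q" using that unfolding nbhds_def N_def by (rule imageI)
    then have "b (N u) \<in> {0..<card (nbhds E ?P ?Q)}" using bij_betwE[OF b] by blast
    then show ?thesis using step.hyps(3) by simp
  qed
  define f where "f i = (if \<exists>u\<in>?P. l u = i then b (N (SOME u. u \<in> ?P \<and> l u = i)) else 0)" for i
  have f: "f (l u) = b (N u)" if u: "u \<in> ?P" for u
  proof -
    define u' where "u' = (SOME x. x \<in> ?P \<and> l x = l u)"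
    have "u' \<in> ?P \<and> l u' = l u" unfolding u'_def by (rule someI[of _ u]) (use u in auto)
    then have "N u' = N u" using l(3) u unfolding N_def by blast
    moreover have "f (l u) = b (N u')" using u unfolding f_def u'_def by auto
    ultimately show ?thesis by simp
  qed
  have "f i < Suc k" for i
  proof (cases "\<exists>u\<in>?P. l u = i")
    case True
    then obtain u where "u \<in> ?P" "l u = i" by blast
    then show ?thesis using f[of u] bN[of u] by simp
  qed (simp add: f_def)
  with cw_relabel_many[of "Suc k" "graph_on ?P E" l f] l(1,2)
  obtain l' where l': "cw_construct ?m (graph_on ?P E) l'" "\<forall>u\<in>?P. l' u = f (l u)"
    by (auto simp: less_Suc_eq_le)
  have "N u = N u'" if "u \<in> ?P" "u' \<in> ?P" "l' u = l' u'" for u u'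
  proof -
    have "b (N u) = b (N u')" using that l'(2) f by simp
    moreover have "N u \<in> nbhds E ?P ?Q" "N u' \<in> nbhds E ?P ?Q"
      using that(1,2) unfolding nbhds_def N_def by (blast intro: imageI)+
    ultimately show ?thesis using bij_betw_imp_inj_on[OF b] by (auto dest: inj_onD)
  qed
  then have "\<forall>u\<in>?P. \<forall>u'\<in>?P. l' u = l' u' \<longrightarrow> (\<forall>w\<in>?Q. E u w = E u' w)"
    unfolding N_def by blast
  moreover have "\<forall>u\<in>?P. l' u < k" using l'(2) f bN by simp
  ultimately show ?case using l'(1) by blast
qed

section \<open>Layouts up to a bounded set and complementation between classes\<close>

lemma layout_modify_degree_le_2:
  assumes "finite V" and "finite S" and "card S \<le> s" and "c ` V \<subseteq> {..<k}"
    and symE: "\<And>u w. E u w \<Longrightarrow> E w u" and symR: "\<And>i j. R i j \<Longrightarrow> R j i"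
    and deg: "\<And>u. u \<in> V - S \<Longrightarrow> card {w \<in> V - S. w \<noteq> u \<and> E u w \<noteq> R (c u) (c w)} \<le> 2"
  shows "layout ((s + k * 2 ^ s) * 3) V E V"
proof -
  \<comment> \<open>\<open>H\<close> complements \<open>E\<close> between the classes related by
    \<open>R\<close> and isolates \<open>S\<close>; \<open>deg\<close> bounds its degrees by
    two.\<close>
  define H where "H u w \<longleftrightarrow> u \<in> V - S \<and> w \<in> V - S \<and> w \<noteq> u \<and> E u w \<noteq> R (c u) (c w)" for u w
  have "layout 3 V H V"
  proof (rule layout_degree_le_2[OF assms(1)])
    show "H w u" if "H u w" for u w
      using that symE[of u w] symE[of w u] symR[of "c u" "c w"] symR[of "c w" "c u"]
      unfolding H_def by blast
    show "card {w \<in> V. H u w} \<le> 2" if "u \<in> V" for u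
    proof (cases "u \<in> S")
      case True
      then show ?thesis by (simp add: H_def)
    next
      case False
      then have "{w \<in> V. H u w} = {w \<in> V - S. w \<noteq> u \<and> E u w \<noteq> R (c u) (c w)}"
        using that unfolding H_def by blast
      then show ?thesis using deg[of u] that False by simp
    qed
  qed
  then show ?thesis
    using assms(2-4) by (rule layout_modify[where R = R]) (auto simp: H_def)
qed

lemma layout_cluster_outside:
  assumes "finite V" and "finite S" and "card S \<le> s"
    and symE: "\<And>u w. E u w \<Longrightarrow> E w u"
    and trans: "\<And>u v w. u \<in> V - S \<Longrightarrow> v \<in> V - S \<Longrightarrow> w \<in> V - S \<Longrightarrow>
      E u v \<Longrightarrow> E v w \<Longrightarrow> u \<noteq> w \<Longrightarrow> E u w"
  shows "layout ((s + 2 ^ s) * 2) V E V"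
proof -
  define H where "H u w \<longleftrightarrow> u \<in> V - S \<and> w \<in> V - S \<and> E u w" for u w
  have "layout 2 V H V"
    using symE trans by (intro layout_cluster[OF assms(1)]) (unfold H_def, blast+)
  \<comment> \<open>One class and no complementation suffice for cliques.\<close>
  from layout_modify[OF this assms(2,3), of "\<lambda>_. 0" 1 E "\<lambda>_ _. False"]
  show ?thesis by (simp add: H_def image_subset_iff)
qed

section \<open>Graphs without induced diamond and induced \<open>2P\<^sub>1 + P\<^sub>3\<close>\<close>

lemma two_outside:
  assumes "finite B" and "card B + 2 \<le> card X"
  obtains p q where "p \<in> X" "q \<in> X" "p \<notin> B" "q \<notin> B" "p \<noteq> q"
proof -
  have "finite X" using assms(2) by (metis card.infinite add_is_0 le_zero_eq zero_neq_numeral)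
  have "2 \<le> card (X - B)" using diff_card_le_card_Diff[OF assms(1), of X] assms(2) by linarith
  then have "\<not> card (X - B) \<le> Suc 0" by simp
  then show ?thesis
    using that card_le_Suc0_iff_eq[of "X - B"] \<open>finite X\<close> by blast
qed

lemma card_Un_le_add: "card A \<le> a \<Longrightarrow> card B \<le> b \<Longrightarrow> card (A \<union> B) \<le> a + b"
  by (rule order_trans[OF card_Un_le add_mono])

lemma card_UN_le_mult:
  assumes "finite I" and "\<And>i. i \<in> I \<Longrightarrow> card (A i) \<le> b"
  shows "card (\<Union>i\<in>I. A i) \<le> card I * b"
proof -
  have "card (\<Union>i\<in>I. A i) \<le> (\<Sum>i\<in>I. card (A i))" by (rule card_UN_le[OF assms(1)])
  also have "\<dots> \<le> of_nat (card I) * b" by (rule sum_bounded_above[OF assms(2)])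
  finally show ?thesis by simp
qed

text \<open>Each forbidden subgraph becomes an implication whose conclusion is an edge that destroys
  it: between the two non-adjacent vertices of a diamond, or between the two isolated vertices of
  \<open>2P\<^sub>1 + P\<^sub>3\<close>. The distinctness conditions not listed follow from
  \<open>sym\<close> and \<open>irr\<close>.\<close>

locale diamond_2P1_P3_free =
  fixes V :: "'a set" and E :: "'a \<Rightarrow> 'a \<Rightarrow> bool"
  assumes fin: "finite V"
    and sym: "E u w \<Longrightarrow> E w u"
    and irr: "\<not> E u u"
    and verts: "E u w \<Longrightarrow> u \<in> V"
    and diamond: "E a b \<Longrightarrow> E a x \<Longrightarrow> E b x \<Longrightarrow> E a y \<Longrightarrow> E b y \<Longrightarrow> x \<noteq> y \<Longrightarrow> E x y"
    and path: "E a b \<Longrightarrow> E b c \<Longrightarrow> \<not> E a c \<Longrightarrow> a \<noteq> c \<Longrightarrow> p \<in> V \<Longrightarrow> q \<in> V \<Longrightarrow> p \<noteq> q \<Longrightarrow>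
      \<not> E p a \<Longrightarrow> \<not> E p b \<Longrightarrow> \<not> E p c \<Longrightarrow> \<not> E q a \<Longrightarrow> \<not> E q b \<Longrightarrow> \<not> E q c \<Longrightarrow> E p q"
begin

section \<open>Independent sets with their low and high vertices\<close>

definition stable :: "'a set \<Rightarrow> bool" where
  "stable X \<longleftrightarrow> X \<subseteq> V \<and> (\<forall>u\<in>X. \<forall>w\<in>X. \<not> E u w)"

definition complete :: "'a set \<Rightarrow> bool" where
  "complete X \<longleftrightarrow> X \<subseteq> V \<and> (\<forall>u\<in>X. \<forall>w\<in>X. u \<noteq> w \<longrightarrow> E u w)"

definition low :: "'a \<Rightarrow> 'a set \<Rightarrow> bool" where
  "low u X \<longleftrightarrow> (\<forall>i\<in>X. \<forall>j\<in>X. E u i \<longrightarrow> E u j \<longrightarrow> i = j)"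

definition high :: "'a \<Rightarrow> 'a set \<Rightarrow> bool" where
  "high u X \<longleftrightarrow> (\<forall>i\<in>X. \<forall>j\<in>X. \<not> E u i \<longrightarrow> \<not> E u j \<longrightarrow> i = j)"

lemma finite_sub: "X \<subseteq> V \<Longrightarrow> finite X"
  by (rule finite_subset[OF _ fin])

lemma card_le_1: "X \<subseteq> V \<Longrightarrow> (\<And>x y. x \<in> X \<Longrightarrow> y \<in> X \<Longrightarrow> x = y) \<Longrightarrow> card X \<le> 1"
  using card_le_Suc0_iff_eq[OF finite_sub] by simp

lemma card_low: "X \<subseteq> V \<Longrightarrow> low u X \<Longrightarrow> card {i \<in> X. E u i} \<le> 1"
  by (rule card_le_1) (auto simp: low_def)

lemma card_high: "X \<subseteq> V \<Longrightarrow> high u X \<Longrightarrow> card {i \<in> X. \<not> E u i} \<le> 1"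
  by (rule card_le_1) (auto simp: high_def)

text \<open>Closed neighbourhoods matter because \<open>u\<close> may lie in \<open>X\<close>; in
  that case stability leaves only \<open>u\<close> itself.\<close>

lemma card_low_closed: "stable X \<Longrightarrow> low u X \<Longrightarrow> card {i \<in> X. i = u \<or> E u i} \<le> 1"
  by (rule card_le_1) (unfold low_def stable_def, blast+)

text \<open>Two neighbours \<open>a\<close>, \<open>c\<close> and two non-neighbours
  \<open>p\<close>, \<open>q\<close> of \<open>u\<close> in \<open>X\<close> would give the path
  \<open>a u c\<close> with isolated \<open>p\<close> and \<open>q\<close>.\<close>

lemma low_or_high:
  assumes "stable X" and "u \<in> V"
  shows "low u X \<or> high u X"
proof (rule ccontr)
  assume "\<not> (low u X \<or> high u X)"
  then obtain a c p q where *: "a \<in> X" "c \<in> X" "p \<in> X" "q \<in> X" "E u a" "E u c" "a \<noteq> c"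
    "\<not> E u p" "\<not> E u q" "p \<noteq> q"
    unfolding low_def high_def by blast
  have "\<not> E p u" "\<not> E q u" "E a u" using * sym by blast+
  then have "E p q" using * assms by (intro path[of a u c p q]) (auto simp: stable_def)
  with * assms show False by (auto simp: stable_def)
qed

text \<open>An induced path \<open>a b c\<close> of low vertices contains or sees at most three
  vertices of \<open>I\<close>; two of the others would serve as isolated vertices. Hence 5 = 3 +
  2.\<close>

lemma low_cluster:
  assumes I: "stable I" "5 \<le> card I" and low: "low a I" "low b I" "low c I"
    and "E a b" "E b c" "a \<noteq> c"
  shows "E a c"
proof (rule ccontr)
  assume "\<not> E a c"
  let ?N = "\<lambda>u. {i \<in> I. i = u \<or> E u i}"
  let ?B = "?N a \<union> ?N b \<union> ?N c"
  have "card ?B \<le> 1 + 1 + 1" by (intro card_Un_le_add card_low_closed I low)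
  moreover have "finite ?B" using I finite_sub by (auto simp: stable_def)
  ultimately obtain p q where pq: "p \<in> I" "q \<in> I" "p \<notin> ?B" "q \<notin> ?B" "p \<noteq> q"
    using two_outside[of ?B I] I by auto
  have "\<not> E p x" "\<not> E q x" if "x \<in> {a, b, c}" for x using pq sym that by blast+
  then have "E p q"
    using pq assms \<open>\<not> E a c\<close> by (intro path[of a b c p q]) (auto simp: stable_def)
  with pq I show False by (auto simp: stable_def)
qed

text \<open>The ends of an edge in \<open>D\<close> miss at most two vertices of \<open>I\<close> in
  all, so they have two common neighbours there. These are not adjacent and complete a
  diamond.\<close>

lemma high_stable:
  assumes I: "stable I" "4 \<le> card I" and "D \<subseteq> V" and high: "\<And>d. d \<in> D \<Longrightarrow> high d I"
  shows "stable D"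
proof -
  have False if "u \<in> D" "w \<in> D" "E u w" for u w
  proof -
    let ?B = "{i \<in> I. \<not> E u i} \<union> {i \<in> I. \<not> E w i}"
    have "I \<subseteq> V" using I by (simp add: stable_def)
    then have "card ?B \<le> 1 + 1" by (intro card_Un_le_add card_high high that)
    moreover have "finite ?B" using I finite_sub by (auto simp: stable_def)
    ultimately obtain p q where pq: "p \<in> I" "q \<in> I" "p \<notin> ?B" "q \<notin> ?B" "p \<noteq> q"
      using two_outside[of ?B I] I by auto
    then have "E p q" using that by (intro diamond[of u w p q]) auto
    with pq I show False by (auto simp: stable_def)
  qed
  with \<open>D \<subseteq> V\<close> show ?thesis unfolding stable_def by blast
qed

section \<open>A large independent set\<close>

lemma layout_two_stable_clique:
  assumes V: "V = D \<union> Ch \<union> Cl" and disj: "D \<inter> Ch = {}" "D \<inter> Cl = {}" "Ch \<inter> Cl = {}"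
    and D: "stable D" and Ch: "stable Ch" and Cl: "complete Cl"
    and highD: "\<And>d. d \<in> D \<Longrightarrow> high d Ch" and highCh: "\<And>c. c \<in> Ch \<Longrightarrow> high c D"
    and lowCl: "\<And>c. c \<in> Cl \<Longrightarrow> low c D"
    and attached: "card {h \<in> Ch. \<exists>c\<in>Cl. E h c} \<le> 1"
  shows "layout 42 V E V"
proof -
  define S1 where "S1 = {h \<in> Ch. \<exists>c\<in>Cl. E h c}"
  define S2 where "S2 = {d \<in> D. \<not> low d Cl}"
  have S1: "card S1 \<le> 1" using attached by (simp add: S1_def)
  have sub: "D \<subseteq> V" "Ch \<subseteq> V" "Cl \<subseteq> V" using V by auto
  have edge: "E u w" if "u \<in> Cl" "w \<in> Cl" "u \<noteq> w" for u w
    using that Cl by (auto simp: complete_def)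
  have no_edge: "\<not> E u w" if "u \<in> D \<and> w \<in> D \<or> u \<in> Ch \<and> w \<in> Ch" for u w
    using that D Ch unfolding stable_def by blast
  have part: "x \<in> D \<or> x \<in> Ch \<or> x \<in> Cl" if "x \<in> V" for x
    using that V by blast
  \<comment> \<open>A vertex of \<open>S2\<close> has two neighbours \<open>x\<close>,
    \<open>y\<close> in \<open>Cl\<close> and so, without diamonds, sees all of \<open>Cl\<close>.
    Two such vertices would give some \<open>z\<close> in \<open>Cl\<close> two neighbours in
    \<open>D\<close>.\<close>
  have "d = d'" if dd: "d \<in> S2" "d' \<in> S2" for d d'
  proof -
    from dd obtain x y z where *: "d \<in> D" "d' \<in> D" "x \<in> Cl" "y \<in> Cl" "z \<in> Cl"
      "x \<noteq> y" "E d x" "E d y" "E d' z"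
      unfolding S2_def low_def by blast
    have "E d z"
    proof (cases "z = x \<or> z = y")
      case False
      then have "E x y" "E x z" "E y z" using * edge by auto
      moreover have "d \<noteq> z" using * disj by blast
      ultimately show ?thesis using sym[OF *(7)] sym[OF *(8)] by (intro diamond[of x y d z])
    qed (use * in auto)
    then have "E z d" "E z d'" using sym *(9) by blast+
    moreover have "low z D" using *(5) by (rule lowCl)
    ultimately show ?thesis using * by (auto simp: low_def)
  qed
  then have S2: "card S2 \<le> 1"
    by (rule card_le_1[rotated]) (use sub in \<open>auto simp: S2_def\<close>)
  define S where "S = S1 \<union> S2"
  have S: "finite S" "card S \<le> 1 + 1"
    using finite_sub[of S] sub card_Un_le_add[OF S1 S2] by (auto simp: S_def S1_def S2_def)
  define c where "c u = (if u \<in> D then 0 else if u \<in> Ch then 1 else 2 :: nat)" for u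
  \<comment> \<open>Complementing between \<open>D\<close> and \<open>Ch\<close> and inside
    \<open>Cl\<close> leaves, outside \<open>S\<close>, only a matching between \<open>D\<close> and
    \<open>Ch\<close> and one between \<open>D\<close> and \<open>Cl\<close>.\<close>
  define R where "R i j \<longleftrightarrow> i = 0 \<and> j = 1 \<or> i = 1 \<and> j = 0 \<or> i = 2 \<and> j = 2" for i j :: nat
  have "layout ((1 + 1 + 3 * 2 ^ (1 + 1)) * 3) V E V"
  proof (rule layout_modify_degree_le_2[OF fin S, where c = c and R = R])
    show "c ` V \<subseteq> {..<3}" by (auto simp: c_def)
    show "R j i" if "R i j" for i j using that by (auto simp: R_def)
    fix u assume u: "u \<in> V - S"
    let ?W = "{w \<in> V - S. w \<noteq> u \<and> E u w \<noteq> R (c u) (c w)}"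
    have c: "c x = 0 \<longleftrightarrow> x \<in> D" "c x = 1 \<longleftrightarrow> x \<in> Ch" "c x = 2 \<longleftrightarrow> x \<in> Cl" if "x \<in> V" for x
      using that disj V by (auto simp: c_def)
    have W: "E u w \<longleftrightarrow> \<not> (u \<in> D \<and> w \<in> Ch \<or> u \<in> Ch \<and> w \<in> D \<or> u \<in> Cl \<and> w \<in> Cl)"
      if "w \<in> ?W" for w
      using that u c[of u] c[of w] by (auto simp: R_def)
    consider "u \<in> D" | "u \<in> Ch" | "u \<in> Cl" using u V by blast
    then show "card ?W \<le> 2"
    proof cases
      case 1
      let ?A = "{w \<in> Ch. \<not> E u w} \<union> {w \<in> Cl. E u w}"
      have "low u Cl" using 1 u by (auto simp: S_def S2_def)
      then have "card ?A \<le> 1 + 1" by (intro card_Un_le_add card_low card_high sub highD 1)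
      moreover have "?W \<subseteq> ?A"
      proof
        fix w assume w: "w \<in> ?W"
        show "w \<in> ?A" using W[OF w] w 1 part[of w] disj no_edge[of u w] by blast
      qed
      moreover have "finite ?A" using finite_sub[of ?A] sub by blast
      ultimately show ?thesis using card_mono[of ?A ?W] by linarith
    next
      case 2
      have "card {w \<in> D. \<not> E u w} \<le> 1" by (intro card_high sub highCh 2)
      moreover have "?W \<subseteq> {w \<in> D. \<not> E u w}"
      proof
        fix w assume w: "w \<in> ?W"
        have "\<not> (w \<in> Cl \<and> E u w)" using 2 u by (auto simp: S_def S1_def)
        then show "w \<in> {w \<in> D. \<not> E u w}" using W[OF w] w 2 part[of w] disj no_edge[of u w] by blast
      qed
      ultimately show ?thesis
        using card_mono[of "{w \<in> D. \<not> E u w}" ?W] finite_sub[OF sub(1)] by simp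
    next
      case 3
      have "card {w \<in> D. E u w} \<le> 1" by (intro card_low sub lowCl 3)
      moreover have "?W \<subseteq> {w \<in> D. E u w}"
      proof
        fix w assume w: "w \<in> ?W"
        have "\<not> (w \<in> Ch \<and> E w u)" using 3 w by (auto simp: S_def S1_def)
        then have "\<not> (w \<in> Ch \<and> E u w)" using sym by blast
        moreover have "w \<noteq> u" using w by simp
        ultimately show "w \<in> {w \<in> D. E u w}" using W[OF w] w 3 part[of w] disj edge[of u w] by blast
      qed
      ultimately show ?thesis
        using card_mono[of "{w \<in> D. E u w}" ?W] finite_sub[OF sub(1)] by simp
    qed
  qed (rule sym)
  then show ?thesis by simp
qed

text \<open>\<open>high_stable\<close> applies twice: for \<open>I\<close> it makes \<open>D\<close>
  independent, and for the large set \<open>D\<close> it makes the vertices that are high for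
  \<open>D\<close> independent. The vertices low for \<open>D\<close> turn out to be a
  clique.\<close>

lemma layout_of_two_stable:
  assumes I: "stable I" "6 \<le> card I"
    and D_def: "D = {u \<in> V. \<not> low u I}" and D6: "6 \<le> card D"
  shows "layout 42 V E V"
proof -
  have DV: "D \<subseteq> V" by (auto simp: D_def)
  have highD: "high d I" if "d \<in> D" for d using that low_or_high[OF I(1)] by (auto simp: D_def)
  have D: "stable D" using I by (intro high_stable[OF I(1) _ DV] highD) auto
  define Ch where "Ch = {u \<in> V - D. \<not> low u D}"
  define Cl where "Cl = {u \<in> V - D. low u D}"
  have V: "V = D \<union> Ch \<union> Cl" and disj: "D \<inter> Ch = {}" "D \<inter> Cl = {}" "Ch \<inter> Cl = {}"
    and sub: "Ch \<subseteq> V" "Cl \<subseteq> V"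
    using DV by (auto simp: Ch_def Cl_def)
  have highCh: "high u D" if "u \<in> Ch" for u using that low_or_high[OF D] by (auto simp: Ch_def)
  have Ch: "stable Ch" using D6 by (intro high_stable[OF D _ sub(1)] highCh) auto
  have lowI: "low u I" if "u \<in> Ch \<union> Cl" for u using that by (auto simp: Ch_def Cl_def D_def)
  have IV: "I \<subseteq> V" using I by (simp add: stable_def)
  have finI: "finite {i \<in> I. Q i}" for Q using finite_sub[OF IV] by simp
  \<comment> \<open>If \<open>u\<close> and \<open>w\<close> were not adjacent, some
    \<open>d\<close> in \<open>D\<close> and two neighbours \<open>p\<close>, \<open>q\<close> of
    \<open>d\<close> in \<open>I\<close>, all away from \<open>u\<close> and \<open>w\<close>, would
    give the path \<open>p d q\<close> with isolated \<open>u\<close> and \<open>w\<close>.\<close>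
  have Cl: "E u w" if uw: "u \<in> Cl" "w \<in> Cl" "u \<noteq> w" for u w
  proof -
    let ?N = "\<lambda>X u. {i \<in> X. i = u \<or> E u i}"
    have low: "low u D" "low w D" using uw by (auto simp: Cl_def)
    have "card (?N D u \<union> ?N D w) \<le> 1 + 1" by (intro card_Un_le_add card_low_closed D low)
    moreover have "finite (?N D u \<union> ?N D w)" using finite_sub[OF DV] by simp
    ultimately obtain d where d: "d \<in> D" "d \<notin> ?N D u" "d \<notin> ?N D w"
      using two_outside[of "?N D u \<union> ?N D w" D] D6 by auto
    let ?B = "{i \<in> I. \<not> E d i} \<union> ?N I u \<union> ?N I w"
    have "card ?B \<le> 1 + 1 + 1"
      using uw d by (intro card_Un_le_add card_low_closed card_high IV I lowI highD) auto
    then obtain p q where pq: "p \<in> I" "q \<in> I" "p \<notin> ?B" "q \<notin> ?B" "p \<noteq> q"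
      using two_outside[of ?B I] I finI by auto
    then have "\<not> E p q" "E p d" "E d q" using I sym by (auto simp: stable_def)
    then show "E u w"
      using uw d pq sub by (intro path[of p d q u w]) auto
  qed
  \<comment> \<open>\<open>I\<close> avoids \<open>D\<close> and has at most one vertex in the
    clique \<open>Cl\<close>, so \<open>d\<close> has two neighbours in \<open>I\<close> that belong
    to \<open>Ch\<close>. Not being low for \<open>Ch\<close>, it is high.\<close>
  have highDCh: "high d Ch" if d: "d \<in> D" for d
  proof -
    have "card (I \<inter> Cl) \<le> 1"
      using IV I Cl by (intro card_le_1) (unfold stable_def, blast+)
    let ?B = "{i \<in> I. \<not> E d i} \<union> (I \<inter> Cl)"
    have "card ?B \<le> 1 + 1"
      using \<open>card (I \<inter> Cl) \<le> 1\<close> by (intro card_Un_le_add card_high IV highD d)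
    moreover have "finite ?B" using finite_sub[OF IV] by simp
    ultimately obtain p q where "p \<in> I" "q \<in> I" "p \<notin> ?B" "q \<notin> ?B" "p \<noteq> q"
      using two_outside[of ?B I] I by auto
    then have pq: "p \<in> I" "q \<in> I" "p \<noteq> q" "E d p" "E d q" "p \<notin> Cl" "q \<notin> Cl" by auto
    have "I \<inter> D = {}" using I by (auto simp: D_def low_def stable_def)
    then have "p \<in> Ch" "q \<in> Ch" using pq IV V by auto
    then have "\<not> low d Ch" using pq by (auto simp: low_def)
    then show ?thesis using low_or_high[OF Ch] d DV by auto
  qed
  define S1 where "S1 = {h \<in> Ch. \<exists>c\<in>Cl. E h c}"
  \<comment> \<open>Being low for \<open>I\<close>, the vertices of \<open>Ch\<close> and
    \<open>Cl\<close> induce disjoint cliques. Two vertices of \<open>Ch\<close> attached to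
    \<open>Cl\<close> would share its clique and be adjacent.\<close>
  have cluster: "E a c" if "a \<in> Ch \<union> Cl" "b \<in> Ch \<union> Cl" "c \<in> Ch \<union> Cl" "E a b" "E b c" "a \<noteq> c"
    for a b c
    using that I by (intro low_cluster[of I a b c] lowI) auto
  have "h = h'" if hh: "h \<in> S1" "h' \<in> S1" for h h'
  proof (rule ccontr)
    assume "h \<noteq> h'"
    from hh obtain c c' where c: "h \<in> Ch" "h' \<in> Ch" "c \<in> Cl" "c' \<in> Cl" "E h c" "E h' c'"
      by (auto simp: S1_def)
    have "E h c'"
    proof (cases "c = c'")
      case False
      have "h \<noteq> c'" using c disj by blast
      then show ?thesis using c Cl[OF c(3,4) False] by (intro cluster[of h c c']) auto
    qed (use c in simp)
    then have "E h h'" using c \<open>h \<noteq> h'\<close> sym[OF c(6)] by (intro cluster[of h c' h']) auto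
    with c Ch show False by (auto simp: stable_def)
  qed
  then have S1: "card S1 \<le> 1"
    by (rule card_le_1[rotated]) (use sub in \<open>auto simp: S1_def\<close>)
  have "complete Cl" using sub Cl by (auto simp: complete_def)
  then show ?thesis
    using S1 by (intro layout_two_stable_clique[OF V disj D Ch] highDCh highCh)
      (auto simp: Cl_def S1_def)
qed

lemma layout_of_stable:
  assumes I: "stable I" "6 \<le> card I"
  shows "layout 74 V E V"
proof -
  define D where "D = {u \<in> V. \<not> low u I}"
  show ?thesis
  proof (cases "6 \<le> card D")
    case True
    show ?thesis by (rule layout_mono[OF layout_of_two_stable[OF I D_def True]]) simp
  next
    case False
    \<comment> \<open>Without the at most five vertices of \<open>D\<close>, all vertices are low
      for \<open>I\<close> and the graph is a union of cliques.\<close>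
    have "layout ((5 + 2 ^ 5) * 2) V E V"
    proof (rule layout_cluster_outside[of V D])
      show "E u w" if "u \<in> V - D" "v \<in> V - D" "w \<in> V - D" "E u v" "E v w" "u \<noteq> w" for u v w
        using that I by (intro low_cluster[of I u v w]) (auto simp: D_def)
    qed (use fin False sym in \<open>auto simp: D_def\<close>)
    then show ?thesis by simp
  qed
qed

section \<open>Maximal cliques and the case of no large independent set\<close>

definition max_clique :: "'a set \<Rightarrow> bool" where
  "max_clique K \<longleftrightarrow> complete K \<and> (\<forall>v\<in>V - K. \<exists>u\<in>K. \<not> E v u)"

lemma max_clique_sub: "max_clique K \<Longrightarrow> K \<subseteq> V"
  by (simp add: max_clique_def complete_def)

lemma max_clique_edge: "max_clique K \<Longrightarrow> u \<in> K \<Longrightarrow> w \<in> K \<Longrightarrow> u \<noteq> w \<Longrightarrow> E u w"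
  unfolding max_clique_def complete_def by blast

lemma max_clique_extend:
  assumes "complete K"
  obtains L where "max_clique L" "K \<subseteq> L"
proof -
  have "finite {L. complete L}"
    by (rule finite_subset[of _ "Pow V"]) (auto simp: complete_def fin)
  from finite_has_maximal2[OF this, of K] assms
  obtain L where L: "complete L" "K \<subseteq> L" "\<And>M. complete M \<Longrightarrow> L \<subseteq> M \<Longrightarrow> L = M"
    by auto
  have "\<exists>u\<in>L. \<not> E v u" if "v \<in> V - L" for v
  proof (rule ccontr)
    assume "\<not> ?thesis"
    then have "complete (insert v L)" using L(1) that sym by (auto simp: complete_def)
    with L(3)[of "insert v L"] that show False by auto
  qed
  then have "max_clique L" using L(1) by (simp add: max_clique_def)
  then show ?thesis using L(2) by (rule that)
qed

text \<open>Two neighbours of \<open>v\<close> in \<open>K\<close>, a non-neighbour in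
  \<open>K\<close> and \<open>v\<close> itself would form a diamond.\<close>

lemma max_clique_low:
  assumes K: "max_clique K" and v: "v \<in> V - K"
  shows "low v K"
proof (rule ccontr)
  assume "\<not> low v K"
  then obtain i j where ij: "i \<in> K" "j \<in> K" "E v i" "E v j" "i \<noteq> j" by (auto simp: low_def)
  obtain u where u: "u \<in> K" "\<not> E v u" using K v by (auto simp: max_clique_def)
  have "E v u"
    using ij u v sym max_clique_edge[OF K] by (intro diamond[of i j v u]) auto
  with u show False by simp
qed

lemma max_clique_not_subset:
  assumes "max_clique K" "max_clique L" "K \<noteq> L"
  shows "\<not> L \<subseteq> K"
proof
  assume "L \<subseteq> K"
  then obtain v where "v \<in> K" "v \<notin> L" using assms(3) by blast
  then obtain u where "u \<in> L" "\<not> E v u"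
    using assms(2) max_clique_sub[OF assms(1)] unfolding max_clique_def by blast
  with \<open>L \<subseteq> K\<close> \<open>v \<in> K\<close> \<open>v \<notin> L\<close> max_clique_edge[OF assms(1), of v u] show False by blast
qed

text \<open>A vertex of \<open>L\<close> outside \<open>K\<close> sees the whole intersection, yet
  is low for \<open>K\<close>.\<close>

lemma max_clique_meet:
  assumes K: "max_clique K" and L: "max_clique L" and "K \<noteq> L"
  shows "card (K \<inter> L) \<le> 1"
proof -
  obtain v where v: "v \<in> L" "v \<notin> K" using max_clique_not_subset[OF assms] by blast
  then have "low v K" using max_clique_low[OF K] max_clique_sub[OF L] by blast
  then have "x = y" if "x \<in> K \<inter> L" "y \<in> K \<inter> L" for x y
    using that v max_clique_edge[OF L, of v] unfolding low_def by blast
  then show ?thesis using max_clique_sub[OF K] by (intro card_le_1) auto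
qed

text \<open>For greedy choices: each \<open>x\<close> in \<open>X\<close> rules out at most one
  vertex of \<open>K\<close>, and \<open>T\<close> collects further vertices to avoid.\<close>

lemma max_clique_pick:
  assumes K: "max_clique K" and X: "X \<subseteq> V - K" and T: "finite T" and "card X + card T < card K"
  obtains p where "p \<in> K" "p \<notin> T" "\<And>x. x \<in> X \<Longrightarrow> \<not> E x p"
proof -
  let ?B = "(\<Union>x\<in>X. {i \<in> K. E x i}) \<union> T"
  have finX: "finite X" and finK: "finite K" using X finite_sub max_clique_sub[OF K] by auto
  have "card (\<Union>x\<in>X. {i \<in> K. E x i}) \<le> card X * 1"
    using X by (intro card_UN_le_mult finX card_low max_clique_sub max_clique_low K) auto
  then have "card ?B \<le> card X * 1 + card T" by (intro card_Un_le_add) auto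
  moreover have "finite ?B" using finX finK T by auto
  ultimately have "\<not> K \<subseteq> ?B" using assms(4) card_mono[of ?B K] by auto
  with that show ?thesis by blast
qed

text \<open>The size 11 = 5 + 5 + 1 suits a greedy choice among six such cliques: up to five earlier
  vertices exclude at most one vertex each, and so do the five other cliques by
  \<open>max_clique_meet\<close>.\<close>

definition big :: "'a set set" where
  "big = {K. max_clique K \<and> 11 \<le> card K}"

lemma finite_big: "finite big"
  by (rule finite_subset[of _ "Pow V"]) (auto simp: big_def fin dest: max_clique_sub)

text \<open>With six cliques this yields an independent set of size six. Choosing each vertex
  outside the other members of \<open>F\<close> ensures that earlier choices lie outside the clique
  treated next, as \<open>max_clique_pick\<close> demands.\<close>

lemma big_transversal:
  assumes F: "F \<subseteq> big" "card F \<le> 6" and "G \<subseteq> F"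
  shows "\<exists>X. stable X \<and> card X = card G \<and> X \<subseteq> (\<Union>K\<in>G. K - \<Union>(F - {K}))"
proof -
  have finF: "finite F" using F(1) finite_big finite_subset by blast
  then have "finite G" using assms(3) finite_subset by blast
  then show ?thesis using assms(3)
  proof (induction G)
    case empty
    show ?case by (intro exI[of _ "{}"]) (auto simp: stable_def)
  next
    case (insert K G)
    then obtain X where X: "stable X" "card X = card G" "X \<subseteq> (\<Union>K\<in>G. K - \<Union>(F - {K}))"
      by auto
    have KF: "K \<in> F" using insert by auto
    have K: "max_clique K" "11 \<le> card K" using insert F by (auto simp: big_def)
    let ?T = "\<Union>L\<in>F - {K}. K \<inter> L"
    have FK: "card (F - {K}) \<le> 5" using KF F(2) by simp
    have "card ?T \<le> card (F - {K}) * 1"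
      using F K finF by (intro card_UN_le_mult max_clique_meet) (auto simp: big_def)
    moreover have "card X \<le> card (F - {K})"
      unfolding X(2) using insert finF by (intro card_mono) auto
    moreover have "X \<subseteq> V - K" using X insert KF by (auto simp: stable_def)
    moreover have "finite ?T" using finite_sub max_clique_sub[OF K(1)] finF by auto
    ultimately obtain p where p: "p \<in> K" "p \<notin> ?T" "\<And>x. x \<in> X \<Longrightarrow> \<not> E x p"
      using max_clique_pick[OF K(1), of X ?T] FK K(2) by auto
    have "stable (insert p X)"
      using X(1) p(1,3) sym irr max_clique_sub[OF K(1)] unfolding stable_def
      by (metis insert_iff insert_subset subsetD)
    moreover have "p \<notin> X" using \<open>X \<subseteq> V - K\<close> p by auto
    then have "card (insert p X) = card (insert K G)"
      using X insert finite_sub by (auto simp: stable_def)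
    moreover have "insert p X \<subseteq> (\<Union>L\<in>insert K G. L - \<Union>(F - {L}))"
      using X(3) p by auto
    ultimately show ?case by blast
  qed
qed

text \<open>There are at most five big cliques. The exceptional set consists of the at most
  \<open>r\<close> vertices they do not cover and the at most 5 * 5 vertices in their pairwise
  intersections; the rest is partitioned into cliques with matchings between them.\<close>

lemma layout_of_no_stable:
  assumes small: "\<And>X. stable X \<Longrightarrow> card X \<le> 5"
    and ramsey: "\<And>W. W \<subseteq> V \<Longrightarrow> r \<le> card W \<Longrightarrow> \<exists>K\<subseteq>W. complete K \<and> card K = 11"
  shows "layout ((r + 25 + 4 * 2 ^ (r + 25)) * 3) V E V"
proof -
  have big5: "card big \<le> 5"
  proof (rule ccontr)
    assume "\<not> card big \<le> 5"
    then obtain F where F: "F \<subseteq> big" "card F = 6"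
      using obtain_subset_with_card_n[of 6 big] by auto
    then show False using big_transversal[of F F] small by fastforce
  qed
  define S0 where "S0 = V - \<Union>big"
  \<comment> \<open>A clique of size 11 among uncovered vertices would extend to a big one.\<close>
  have "card S0 \<le> r"
  proof (rule ccontr)
    assume "\<not> card S0 \<le> r"
    then obtain K where K: "K \<subseteq> S0" "complete K" "card K = 11"
      using ramsey[of S0] by (auto simp: S0_def)
    obtain L where L: "max_clique L" "K \<subseteq> L" using max_clique_extend[OF K(2)] .
    then have "card K \<le> card L" using finite_sub[OF max_clique_sub] by (intro card_mono)
    then have "L \<in> big" using L K by (simp add: big_def)
    then have "K = {}" using K(1) L(2) by (auto simp: S0_def)
    with K(3) show False by simp
  qed
  define pairs where "pairs = {P \<in> big \<times> big. fst P \<noteq> snd P}"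
  define S1 where "S1 = (\<Union>P\<in>pairs. fst P \<inter> snd P)"
  have "card S1 \<le> card pairs * 1"
    unfolding S1_def using finite_big
    by (intro card_UN_le_mult max_clique_meet) (auto simp: pairs_def big_def)
  also have "\<dots> \<le> card (big \<times> big)"
    unfolding mult_1_right using finite_big by (intro card_mono) (auto simp: pairs_def)
  also have "\<dots> \<le> 5 * 5" unfolding card_cartesian_product using big5 by (intro mult_le_mono)
  finally have "card S1 \<le> 5 * 5" .
  define S where "S = S0 \<union> S1"
  have S: "card S \<le> r + 25"
    using card_Un_le_add[OF \<open>card S0 \<le> r\<close> \<open>card S1 \<le> 5 * 5\<close>] by (simp add: S_def)
  have "x \<in> V" if "K \<in> big" "x \<in> K" for K x
    using that max_clique_sub[of K] by (auto simp: big_def)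
  then have "S \<subseteq> V" by (auto simp: S_def S0_def S1_def pairs_def mem_Times_iff)
  then have finS: "finite S" by (rule finite_sub)
  \<comment> \<open>Outside \<open>S\<close> every vertex lies in exactly one big clique; on
    \<open>S\<close> the choice is arbitrary.\<close>
  define \<kappa> where "\<kappa> v = (SOME K. K \<in> big \<and> v \<in> K)" for v
  have \<kappa>: "\<kappa> v \<in> big" "v \<in> \<kappa> v" if "v \<in> V - S" for v
  proof -
    have "\<exists>K. K \<in> big \<and> v \<in> K" using that by (auto simp: S_def S0_def)
    from someI_ex[OF this] show "\<kappa> v \<in> big" "v \<in> \<kappa> v" by (auto simp: \<kappa>_def)
  qed
  have \<kappa>_unique: "K = \<kappa> v" if "v \<in> V - S" "K \<in> big" "v \<in> K" for v K
    using that \<kappa>[OF that(1)] unfolding S_def S1_def pairs_def by force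
  have \<kappa>_edge: "E u w" if "u \<in> V - S" "w \<in> V - S" "\<kappa> u = \<kappa> w" "u \<noteq> w" for u w
    using \<kappa>[OF that(1)] \<kappa>[OF that(2)] that by (auto simp: big_def intro: max_clique_edge)
  show ?thesis
  proof (cases "card big \<le> 3")
    case True
    obtain b where b: "bij_betw b big {0..<card big}"
      using ex_bij_betw_finite_nat[OF finite_big] by blast
    define c where "c v = (if v \<in> V - S then b (\<kappa> v) else 0)" for v
    show ?thesis
    proof (rule layout_modify_degree_le_2[OF fin finS S, where c = c and R = "(=)"])
      have "b (\<kappa> v) < 4" if "v \<in> V - S" for v
        using bij_betwE[OF b] \<kappa>(1)[OF that] True by fastforce
      then show "c ` V \<subseteq> {..<4}" by (auto simp: c_def)
      fix u assume u: "u \<in> V - S"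
      let ?W = "{w \<in> V - S. w \<noteq> u \<and> E u w \<noteq> (c u = c w)}"
      \<comment> \<open>Complementing inside the cliques leaves \<open>u\<close> at most one
        neighbour in each of the at most two other cliques.\<close>
      let ?U = "\<Union>L\<in>big - {\<kappa> u}. {w \<in> L. E u w}"
      have "?W \<subseteq> ?U"
      proof
        fix w assume w: "w \<in> ?W"
        then have wS: "w \<in> V - S" by simp
        have "c u = c w \<longleftrightarrow> \<kappa> u = \<kappa> w"
          using bij_betw_imp_inj_on[OF b] \<kappa>(1)[OF u] \<kappa>(1)[OF wS] u wS
          by (auto simp: c_def inj_on_eq_iff)
        with w \<kappa>_edge[OF u wS] have "E u w" "\<kappa> u \<noteq> \<kappa> w" by auto
        with \<kappa>[OF wS] show "w \<in> ?U" by blast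
      qed
      moreover have "card ?U \<le> card (big - {\<kappa> u}) * 1"
      proof (rule card_UN_le_mult)
        fix L assume L: "L \<in> big - {\<kappa> u}"
        then have "u \<notin> L" using \<kappa>_unique[OF u] by blast
        with L u show "card {w \<in> L. E u w} \<le> 1"
          by (intro card_low max_clique_sub max_clique_low) (auto simp: big_def)
      qed (simp add: finite_big)
      moreover have "card (big - {\<kappa> u}) \<le> 2" using True \<kappa>(1)[OF u] finite_big by simp
      moreover have "finite ?U" by (rule finite_sub) (auto dest: sym verts)
      ultimately show "card ?W \<le> 2" using card_mono[of ?U ?W] by linarith
    qed (use sym in auto)
  next
    case False
    \<comment> \<open>An edge \<open>u v\<close> between two of at least four cliques extends to a
      forbidden subgraph: \<open>w\<close> in the clique of \<open>u\<close> gives the path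
      \<open>w u v\<close>, and \<open>p\<close>, \<open>q\<close> in two further cliques
      \<open>K\<close>, \<open>L\<close> are chosen isolated from it and from each other.\<close>
    have same: "\<kappa> u = \<kappa> v" if uv: "u \<in> V - S" "v \<in> V - S" "E u v" for u v
    proof (rule ccontr)
      assume neq: "\<kappa> u \<noteq> \<kappa> v"
      have "\<not> big \<subseteq> {\<kappa> u, \<kappa> v}" using card_mono[of "{\<kappa> u, \<kappa> v}" big] False neq by auto
      then obtain K where K: "K \<in> big" "K \<noteq> \<kappa> u" "K \<noteq> \<kappa> v" by blast
      have "card {\<kappa> u, \<kappa> v, K} \<le> 3" by (simp add: card_insert_if)
      then have "\<not> big \<subseteq> {\<kappa> u, \<kappa> v, K}" using card_mono[of "{\<kappa> u, \<kappa> v, K}" big] False by auto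
      then obtain L where L: "L \<in> big" "L \<noteq> \<kappa> u" "L \<noteq> \<kappa> v" "L \<noteq> K" by blast
      have bigD: "max_clique M" "11 \<le> card M" "M \<subseteq> V" "finite M" if "M \<in> big" for M
        using that max_clique_sub finite_sub by (auto simp: big_def)
      have meet: "card (M \<inter> N) \<le> 1" if "M \<in> big" "N \<in> big" "M \<noteq> N" for M N
        using that by (intro max_clique_meet) (auto simp: big_def)
      note \<kappa>u = \<kappa>[OF uv(1)] and \<kappa>v = \<kappa>[OF uv(2)]
      have notin: "v \<notin> \<kappa> u" "u \<notin> K" "v \<notin> K" "u \<notin> L" "v \<notin> L"
        using neq K L \<kappa>u \<kappa>v \<kappa>_unique[OF uv(1)] \<kappa>_unique[OF uv(2)] by blast+
      \<comment> \<open>Avoiding the intersections puts \<open>w\<close> outside \<open>K\<close>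
        and \<open>L\<close>, so that it rules out at most one vertex in each.\<close>
      have "card ({u} \<union> (\<kappa> u \<inter> K) \<union> (\<kappa> u \<inter> L)) \<le> 1 + 1 + 1"
        using \<kappa>u K L by (intro card_Un_le_add meet) auto
      then obtain w where w: "w \<in> \<kappa> u" "w \<notin> {u} \<union> (\<kappa> u \<inter> K) \<union> (\<kappa> u \<inter> L)" "\<not> E v w"
        using max_clique_pick[of "\<kappa> u" "{v}" "{u} \<union> (\<kappa> u \<inter> K) \<union> (\<kappa> u \<inter> L)"]
          bigD[OF \<kappa>u(1)] uv notin by auto
      have wV: "w \<in> V" using w(1) bigD(3)[OF \<kappa>u(1)] by blast
      have "card {w, u, v} \<le> 3" by (simp add: card_insert_if)
      moreover have "card (K \<inter> L) \<le> 1" using meet K L by auto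
      ultimately obtain p where p: "p \<in> K" "p \<notin> L" "\<And>x. x \<in> {w, u, v} \<Longrightarrow> \<not> E x p"
        using max_clique_pick[of K "{w, u, v}" "K \<inter> L"] bigD[OF K(1)] uv notin w wV by auto
      have pV: "p \<in> V" using p(1) bigD(3)[OF K(1)] by blast
      have "card {w, u, v, p} \<le> 4" by (simp add: card_insert_if)
      then obtain q where q: "q \<in> L" "\<And>x. x \<in> {w, u, v, p} \<Longrightarrow> \<not> E x q"
        using max_clique_pick[of L "{w, u, v, p}" "{}"] bigD[OF L(1)] uv notin w wV p(2) pV by auto
      have qV: "q \<in> V" using q(1) bigD(3)[OF L(1)] by blast
      have wu: "E w u" using max_clique_edge[OF bigD(1)[OF \<kappa>u(1)]] w \<kappa>u by blast
      have "w \<noteq> v" using w notin by blast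
      moreover have "\<not> E w v" using w(3) sym by blast
      moreover have "\<not> E p x" "\<not> E q x" if "x \<in> {w, u, v}" for x using that p(3) q(2) sym by blast+
      moreover have "p \<noteq> q" using p q by blast
      ultimately have "E p q" using uv wu pV qV by (intro path[of w u v p q]) auto
      with q(2)[of p] show False by simp
    qed
    have "layout ((r + 25 + 2 ^ (r + 25)) * 2) V E V"
    proof (rule layout_cluster_outside[OF fin finS S])
      show "E u w" if "u \<in> V - S" "v \<in> V - S" "w \<in> V - S" "E u v" "E v w" "u \<noteq> w" for u v w
        using that same[of u v] same[of v w] by (intro \<kappa>_edge) auto
    qed (rule sym)
    then show ?thesis by (rule layout_mono) simp
  qed
qed

end

section \<open>A bound uniform in the graph\<close>

theorem layout_bounded:
  "\<exists>k. \<forall>(V :: 'a set) E. diamond_2P1_P3_free V E \<longrightarrow> layout k V E V"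
proof -
  \<comment> \<open>A Ramsey number for cliques of size 11 and independent sets of size 6; it is
    fixed before the graph.\<close>
  obtain r where r: "\<And>(W :: 'a set) F. finite W \<Longrightarrow> r \<le> card W \<Longrightarrow>
      \<exists>X\<subseteq>W. card X = 11 \<and> clique X F \<or> card X = 6 \<and> indep X F"
    using ramsey2[of 11 6, where 'a = 'a] by metis
  define k where "k = (r + 25 + 4 * 2 ^ (r + 25)) * 3"
  have "layout (k + 74) V E V" if "diamond_2P1_P3_free V E" for V :: "'a set" and E
  proof -
    interpret diamond_2P1_P3_free V E by fact
    show ?thesis
    proof (cases "\<exists>I. stable I \<and> 6 \<le> card I")
      case True
      then show ?thesis using layout_of_stable layout_mono le_add2 by blast
    next
      case False
      define F where "F = {{u, w} | u w. E u w}"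
      have F: "{u, w} \<in> F \<longleftrightarrow> E u w" for u w
        using sym by (auto simp: F_def doubleton_eq_iff)
      have "layout k V E V" unfolding k_def
      proof (rule layout_of_no_stable)
        show "card X \<le> 5" if "stable X" for X using False that by force
        fix W assume W: "W \<subseteq> V" "r \<le> card W"
        then obtain X where X: "X \<subseteq> W" "card X = 11 \<and> clique X F \<or> card X = 6 \<and> indep X F"
          using r[OF finite_sub[OF W(1)] W(2), of F] by blast
        have "\<not> (card X = 6 \<and> indep X F)"
        proof
          assume "card X = 6 \<and> indep X F"
          then have "\<not> E u w" if "u \<in> X" "w \<in> X" for u w
            using that F[of u w] irr[of u] unfolding indep_def by (cases "u = w") simp_all
          then have "stable X" using X(1) W(1) by (auto simp: stable_def)
          with False \<open>card X = 6 \<and> indep X F\<close> show False by auto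
        qed
        then have "card X = 11" "complete X"
          using X W(1) by (auto simp: clique_def complete_def F)
        with X(1) show "\<exists>K\<subseteq>W. complete K \<and> card K = 11" by blast
      qed
      then show ?thesis by (rule layout_mono) simp
    qed
  qed
  then show ?thesis by blast
qed

section \<open>Forbidden induced subgraphs\<close>

text \<open>The image of \<open>H\<close> under \<open>f\<close> is the required subgraph; the
  equivalence in \<open>arc\<close> makes it induced.\<close>

lemma not_free_of_embedding:
  assumes G: "pair_graph G" and arcsH: "parcs H \<subseteq> pverts H \<times> pverts H"
    and inj: "inj_on f (pverts H)" and sub: "f ` pverts H \<subseteq> pverts G"
    and arc: "\<And>u v. u \<in> pverts H \<Longrightarrow> v \<in> pverts H \<Longrightarrow> (u, v) \<in> parcs H \<longleftrightarrow> (f u, f v) \<in> parcs G"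
  shows "\<not> free_of H G"
proof -
  interpret G: pair_graph G by fact
  have wfH: "wf_digraph (with_proj H)"
    unfolding wf_digraph_wp_iff using arcsH by unfold_locales auto
  \<comment> \<open>With the projections as head and tail the image is compatible with
    \<open>with_proj G\<close>.\<close>
  define h where "h = \<lparr>iso_verts = f, iso_arcs = map_prod f f, iso_head = snd, iso_tail = fst\<rparr>"
  define F where "F = app_iso h (with_proj H)"
  have h: "pre_digraph.digraph_isomorphism (with_proj H) h"
    unfolding pre_digraph.digraph_isomorphism_def
  proof (intro conjI wfH ballI)
    have "inj_on (map_prod f f) (pverts H \<times> pverts H)" using inj by (intro map_prod_inj_on)
    then show "inj_on (iso_arcs h) (arcs (with_proj H))"
      using inj_on_subset[OF _ arcsH] by (simp add: h_def)
  qed (use inj in \<open>auto simp: h_def\<close>)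
  then have wfF: "wf_digraph F"
    unfolding F_def by (rule wf_digraph.wf_digraphI_app_iso[OF wfH])
  have "parcs H = {(u, v). u \<in> pverts H \<and> v \<in> pverts H \<and> (f u, f v) \<in> parcs G}"
    using arcsH arc by auto
  then have arcsF: "arcs F = {e \<in> parcs G. fst e \<in> f ` pverts H \<and> snd e \<in> f ` pverts H}"
    by (force simp: F_def h_def)
  have "induced_subgraph F (with_proj G)"
    unfolding induced_subgraph_def subgraph_def
    using wfF arcsF sub G.wf_digraph_axioms
    by (auto simp: F_def h_def compatible_def)
  moreover have "digraph_iso (with_proj H) F"
    using h unfolding digraph_iso_def F_def by blast
  then have "digraph_iso F (with_proj H)" by (rule digraph_iso_swap[OF wfH])
  ultimately show ?thesis unfolding free_of_def by blast
qed

lemma diamond_embedding: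
  assumes G: "pair_graph G"
    and edges: "(a, b) \<in> parcs G" "(a, x) \<in> parcs G" "(b, x) \<in> parcs G" "(a, y) \<in> parcs G"
      "(b, y) \<in> parcs G"
    and xy: "x \<noteq> y" "(x, y) \<notin> parcs G"
  shows "\<not> free_of (complement_graph (disjoint_sum (copies 2 (path_graph 1)) (path_graph 2))) G"
proof -
  interpret G: pair_graph G by fact
  have sym: "(v, u) \<in> parcs G" if "(u, v) \<in> parcs G" for u v using that by (rule G.arcs_symmetric)
  have neq: "u \<noteq> v" if "(u, v) \<in> parcs G" for u v using that by (rule G.no_loops')
  have "u \<in> pverts G" if "(u, v) \<in> parcs G" for u v using that by (rule G.in_arcsD1)
  note vert = this this[OF sym]
  \<comment> \<open>Complementation turns the two isolated vertices into the adjacent pair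
    \<open>a\<close>, \<open>b\<close> that sees everything, and the ends of the edge into the
    non-adjacent pair \<open>x\<close>, \<open>y\<close>.\<close>
  define f :: "nat \<times> nat + nat \<Rightarrow> 'a" where
    "f = case_sum (\<lambda>(i, _). if i = 0 then a else b) (\<lambda>j. if j = 0 then x else y)"
  let ?H = "complement_graph (disjoint_sum (copies 2 (path_graph 1)) (path_graph 2))"
  have verts: "pverts ?H = {Inl (0, 0), Inl (1, 0), Inr 0, Inr 1}"
    by (auto simp: complement_graph_def disjoint_sum_def copies_def path_graph_def Plus_def
        lessThan_Suc numeral_2_eq_2)
  have arcs: "parcs ?H = {(u, v). u \<in> pverts ?H \<and> v \<in> pverts ?H \<and> u \<noteq> v \<and>
      (u, v) \<noteq> (Inr 0, Inr 1) \<and> (u, v) \<noteq> (Inr 1, Inr 0)}"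
    unfolding verts
    by (auto simp: complement_graph_def disjoint_sum_def copies_def path_graph_def Plus_def
        lessThan_Suc numeral_2_eq_2)
  show ?thesis
  proof (rule not_free_of_embedding[OF G, where f = f])
    show "parcs ?H \<subseteq> pverts ?H \<times> pverts ?H" unfolding arcs by auto
    show "inj_on f (pverts ?H)" unfolding verts
      using edges[THEN neq] xy(1) by (auto simp: f_def)
    show "f ` pverts ?H \<subseteq> pverts G" unfolding verts
      using edges[THEN vert(1)] edges[THEN vert(2)] by (auto simp: f_def)
    show "(u, v) \<in> parcs ?H \<longleftrightarrow> (f u, f v) \<in> parcs G"
      if "u \<in> pverts ?H" "v \<in> pverts ?H" for u v
    proof -
      have "(u, u) \<notin> parcs G" for u using neq by blast
      moreover have "(y, x) \<notin> parcs G" using xy(2) sym by blast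
      ultimately show ?thesis
        using that unfolding arcs verts
        by (elim insertE emptyE) (simp_all add: f_def xy(2) edges edges[THEN sym])
    qed
  qed
qed

lemma path_embedding:
  assumes G: "pair_graph G"
    and path: "(a, b) \<in> parcs G" "(b, c) \<in> parcs G" "(a, c) \<notin> parcs G" "a \<noteq> c"
    and pq: "p \<in> pverts G" "q \<in> pverts G" "p \<noteq> q"
      "(p, a) \<notin> parcs G" "(p, b) \<notin> parcs G" "(p, c) \<notin> parcs G"
      "(q, a) \<notin> parcs G" "(q, b) \<notin> parcs G" "(q, c) \<notin> parcs G" "(p, q) \<notin> parcs G"
  shows "\<not> free_of (disjoint_sum (copies 2 (path_graph 1)) (path_graph 3)) G"
proof -
  interpret G: pair_graph G by fact
  have sym: "(v, u) \<in> parcs G" if "(u, v) \<in> parcs G" for u v using that by (rule G.arcs_symmetric)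
  have not_sym: "(v, u) \<notin> parcs G" if "(u, v) \<notin> parcs G" for u v using that sym by blast
  have neq: "u \<noteq> v" if "(u, v) \<in> parcs G" for u v using that by (rule G.no_loops')
  have loop: "(u, u) \<notin> parcs G" for u using neq by blast
  have "u \<in> pverts G" if "(u, v) \<in> parcs G" for u v using that by (rule G.in_arcsD1)
  note vert = this this[OF sym]
  define f :: "nat \<times> nat + nat \<Rightarrow> 'a" where
    "f = case_sum (\<lambda>(i, _). if i = 0 then p else q)
      (\<lambda>j. if j = 0 then a else if j = 1 then b else c)"
  let ?H = "disjoint_sum (copies 2 (path_graph 1)) (path_graph 3)"
  have verts: "pverts ?H = {Inl (0, 0), Inl (1, 0), Inr 0, Inr 1, Inr 2}"
    by (auto simp: disjoint_sum_def copies_def path_graph_def Plus_def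
        lessThan_Suc numeral_2_eq_2 numeral_3_eq_3)
  have arcs: "parcs ?H = {(Inr 0, Inr 1), (Inr 1, Inr 0), (Inr 1, Inr 2), (Inr 2, Inr 1)}"
    by (auto simp: disjoint_sum_def copies_def path_graph_def numeral_3_eq_3 less_Suc_eq
        image_iff split_paired_Ex)
  have distinct: "a \<noteq> b" "b \<noteq> c" "p \<noteq> a" "p \<noteq> b" "p \<noteq> c" "q \<noteq> a" "q \<noteq> b" "q \<noteq> c"
    using path pq neq sym by blast+
  show ?thesis
  proof (rule not_free_of_embedding[OF G, where f = f])
    show "parcs ?H \<subseteq> pverts ?H \<times> pverts ?H" unfolding arcs verts by auto
    show "inj_on f (pverts ?H)" unfolding verts
      using distinct path(4) pq(3) by (auto simp: f_def)
    show "f ` pverts ?H \<subseteq> pverts G" unfolding verts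
      using pq(1,2) path(1,2)[THEN vert(1)] path(1,2)[THEN vert(2)] by (auto simp: f_def)
    show "(u, v) \<in> parcs ?H \<longleftrightarrow> (f u, f v) \<in> parcs G"
      if "u \<in> pverts ?H" "v \<in> pverts ?H" for u v
      using that unfolding arcs verts
      by (elim insertE emptyE)
        (simp_all add: f_def path(1,2) path(1,2)[THEN sym] path(3) not_sym[OF path(3)]
          pq(4-10) pq(4-10)[THEN not_sym] loop)
  qed
qed

lemma diamond_2P1_P3_free_if_free_of:
  assumes G: "pair_graph G"
    and "free_of (complement_graph (disjoint_sum (copies 2 (path_graph 1)) (path_graph 2))) G"
    and "free_of (disjoint_sum (copies 2 (path_graph 1)) (path_graph 3)) G"
  shows "diamond_2P1_P3_free (pverts G) (\<lambda>u v. (u, v) \<in> parcs G)"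
proof -
  interpret G: pair_graph G by fact
  show ?thesis
  proof
    show "finite (pverts G)" by (rule G.pair_finite_verts)
    show "(w, u) \<in> parcs G" if "(u, w) \<in> parcs G" for u w using that by (rule G.arcs_symmetric)
    show "(u, u) \<notin> parcs G" for u using G.no_loops' by blast
    show "u \<in> pverts G" if "(u, w) \<in> parcs G" for u w using that by (rule G.in_arcsD1)
  qed (use diamond_embedding[OF G] path_embedding[OF G] assms(2,3) in blast)+
qed

section \<open>Clique-width of the given class\<close>

lemma clique_width_le_layout:
  assumes G: "pair_graph G" and "layout k (pverts G) (\<lambda>u v. (u, v) \<in> parcs G) (pverts G)"
  shows "clique_width G \<le> enat (2 * Suc k)"
proof (cases "pverts G = {}")
  \<comment> \<open>Constructions need a vertex, so the empty graph rests on the convention of width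
    0.\<close>
  case True
  then show ?thesis by (simp add: clique_width_def zero_enat_def)
next
  case False
  interpret G: pair_graph G by fact
  have "graph_on (pverts G) (\<lambda>u v. (u, v) \<in> parcs G) = G"
    using G.in_arcsD1 G.in_arcsD2 by (intro pair_pre_digraph.equality) auto
  moreover obtain l where
    "cw_construct (2 * Suc k) (graph_on (pverts G) (\<lambda>u v. (u, v) \<in> parcs G)) l"
    using layout_cw_construct[OF assms(2) False] G.arcs_symmetric G.no_loops' by blast
  ultimately have "cw_construct (2 * Suc k) G l" by simp
  then have "(INF k \<in> {k. \<exists>l. cw_construct k G l}. enat k) \<le> enat (2 * Suc k)"
    by (intro INF_lower) blast
  with False show ?thesis by (simp add: clique_width_def)
qed

theorem theorem1:
  shows "bounded_clique_width
    {G :: 'a pair_pre_digraph. pair_graph G \<and>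
       free_of (complement_graph (disjoint_sum (copies 2 (path_graph 1)) (path_graph 2))) G \<and>
       free_of (disjoint_sum (copies 2 (path_graph 1)) (path_graph 3)) G}"
proof -
  obtain k where k: "\<And>(V :: 'a set) E. diamond_2P1_P3_free V E \<Longrightarrow> layout k V E V"
    using layout_bounded[where 'a = 'a] by blast
  have "clique_width G \<le> enat (2 * Suc k)"
    if "pair_graph G"
      "free_of (complement_graph (disjoint_sum (copies 2 (path_graph 1)) (path_graph 2))) G"
      "free_of (disjoint_sum (copies 2 (path_graph 1)) (path_graph 3)) G"
    for G :: "'a pair_pre_digraph"
    by (intro clique_width_le_layout[OF that(1)] k diamond_2P1_P3_free_if_free_of that)
  then show ?thesis unfolding bounded_clique_width_def by blast
qed

end
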